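(* Let $\mathbb{F}$ be an algebraically closed field of characteristic zero, let $\mathcal{A}$ be a two-dimensional simple $\mathbb{F}$-algebra with a non-trivial automorphism group, and let $m>0$. Then the Artin–Procesi–Iltyakov Equality $I_m(\mathcal{A})=\mathrm{Tr}(\mathcal{A})_m$ holds for $\mathcal{A}^m$.
   Context: An algebra is a vector space with a bilinear multiplication, not necessarily associative. An algebra is simple if its multiplication is not identically zero and it has no two-sided ideals other than $0$ and itself. For an $n$-dimensional algebra $\mathcal{A}$ over $\mathbb{F}$ with a fixed basis, $\mathbb{F}[\mathcal{A}^m]=\mathbb{F}[x_{ri}:1\leqslant r\leqslant m,1\leqslant i\leqslant n]$ is the algebra of polynomial functions on $\mathcal{A}^m$, where $x_{ri}(a_1,\ldots,a_m)$ is the $i$-th coordinate of $a_r$. The group $\mathrm{Aut}(\mathcal{A})$ of algebra automorphisms acts diagonally on $\mathcal{A}^m$ and $I_m(\mathcal{A})=\{f\in\mathbb{F}[\mathcal{A}^m]: f(g\cdot\underline{a})=f(\underline{a})\ \text{for all } g\in\mathrm{Aut}(\mathcal{A}),\ \underline{a}\in\mathcal{A}^m\}$. Operator traces: let $\mathbb{F}\langle\chi_0,\ldots,\chi_m\rangle$ be the absolutely free (non-associative) unital algebra in letters $\chi_0,\ldots,\chi_m$. If $h\in\mathbb{F}\langle\chi_0,\ldots,\chi_m\rangle$ is homogeneous of degree $1$ in $\chi_0$ (each monomial of $h$ contains $\chi_0$ exactly once), then for $\underline{a}=(a_1,\ldots,a_m)\in\mathcal{A}^m$ let $h(\,\cdot\,,\underline{a}):\mathcal{A}\to\mathcal{A}$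 be the linear operator $b\mapsto h(b,a_1,\ldots,a_m)$ (substitute $\chi_0\to b$, $\chi_r\to a_r$). The operator trace $\mathrm{tr}(h):\mathcal{A}^m\to\mathbb{F}$ is $\mathrm{tr}(h)(\underline{a})=\mathrm{tr}(h(\,\cdot\,,\underline{a}))$; it lies in $I_m(\mathcal{A})$. $\mathrm{Tr}(\mathcal{A})_m$ is the subalgebra of $I_m(\mathcal{A})$ generated by $1$ and all operator traces $\mathrm{tr}(h)$. *)

theory Defs
  imports
    "HOL-Analysis.Finite_Cartesian_Product"
    "HOL-Computational_Algebra.Polynomial"
    "HOL-Library.Poly_Mapping"
begin

text \<open>
  The unital subalgebra, generated by \<open>S\<close>, of the (commutative, associative) algebra of all
  \<open>'a\<close>-valued functions on \<open>'t\<close> with pointwise operations.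
\<close>

inductive_set generated_subalgebra :: "('t \<Rightarrow> 'a::comm_ring_1) set \<Rightarrow> ('t \<Rightarrow> 'a) set"
  for S :: "('t \<Rightarrow> 'a) set" where
  one: "(\<lambda>_. 1) \<in> generated_subalgebra S"
| gen: "f \<in> S \<Longrightarrow> f \<in> generated_subalgebra S"
| smult: "f \<in> generated_subalgebra S \<Longrightarrow> (\<lambda>t. c * f t) \<in> generated_subalgebra S"
| add: "f \<in> generated_subalgebra S \<Longrightarrow> g \<in> generated_subalgebra S
    \<Longrightarrow> (\<lambda>t. f t + g t) \<in> generated_subalgebra S"
| mult: "f \<in> generated_subalgebra S \<Longrightarrow> g \<in> generated_subalgebra S
    \<Longrightarrow> (\<lambda>t. f t * g t) \<in> generated_subalgebra S"

text \<open>
  The \<open>m\<close> letters \<open>\<chi>\<^sub>1, \<dots>, \<chi>\<^sub>m\<close> are indexed by a finite type \<open>'m\<close> with \<open>m\<close> elements; \<open>Chi0\<close> is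
  the distinguished letter \<open>\<chi>\<^sub>0\<close>. A basis of the absolutely free unital algebra consists of the
  empty word \<open>None\<close>, which is the unit, and the nonempty bracketed words. Accordingly, its elements
  are the finitely supported coefficient functions on these monomials.
\<close>

datatype 'm letter = Chi0 | Chi 'm

datatype 'x bracketed_word = Letter 'x | Times "'x bracketed_word" "'x bracketed_word"

type_synonym 'm free_monomial = "'m letter bracketed_word option"

type_synonym ('m, 'a) free_algebra = "'m free_monomial \<Rightarrow>\<^sub>0 'a"

primrec word_degree :: "'x \<Rightarrow> 'x bracketed_word \<Rightarrow> nat" where
  "word_degree x (Letter y) = (if x = y then 1 else 0)"
| "word_degree x (Times u v) = word_degree x u + word_degree x v"

definition monomial_degree :: "'m letter \<Rightarrow> 'm free_monomial \<Rightarrow> nat" where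
  "monomial_degree x w = (case w of None \<Rightarrow> 0 | Some u \<Rightarrow> word_degree x u)"

definition degree_one_in_Chi0 :: "('m, 'a::zero) free_algebra \<Rightarrow> bool" where
  "degree_one_in_Chi0 h \<longleftrightarrow> (\<forall>w\<in>Poly_Mapping.keys h. monomial_degree Chi0 w = 1)"

locale nonassoc_algebra = finite_dimensional_vector_space scale Basis
  for scale :: "'a::field \<Rightarrow> 'b::ab_group_add \<Rightarrow> 'b"
    and Basis :: "'b set" +
  fixes mult :: "'b \<Rightarrow> 'b \<Rightarrow> 'b"
  assumes linear_mult_left: "Vector_Spaces.linear scale scale (\<lambda>x. mult x y)"
    and linear_mult_right: "Vector_Spaces.linear scale scale (\<lambda>y. mult x y)"
begin

definition two_sided_ideal :: "'b set \<Rightarrow> bool" where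
  "two_sided_ideal J \<longleftrightarrow> subspace J \<and> (\<forall>a. \<forall>x\<in>J. mult a x \<in> J \<and> mult x a \<in> J)"

definition simple :: bool where
  "simple \<longleftrightarrow> (\<exists>x y. mult x y \<noteq> 0) \<and> (\<forall>J. two_sided_ideal J \<longrightarrow> J = {0} \<or> J = UNIV)"

definition Aut :: "('b \<Rightarrow> 'b) set" where
  "Aut = {g. Vector_Spaces.linear scale scale g \<and> bij g \<and> (\<forall>x y. g (mult x y) = mult (g x) (g y))}"

definition coordinate :: "'m \<Rightarrow> 'b \<Rightarrow> 'b ^ 'm::finite \<Rightarrow> 'a" where
  "coordinate r e a = representation Basis (a $ r) e"

definition polynomial_functions :: "('b ^ 'm::finite \<Rightarrow> 'a) set" where
  "polynomial_functions = generated_subalgebra {coordinate r e |r e. e \<in> Basis}"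

definition invariants :: "('b ^ 'm::finite \<Rightarrow> 'a) set" where
  "invariants = {f \<in> polynomial_functions. \<forall>g\<in>Aut. \<forall>a. f (\<chi> r. g (a $ r)) = f a}"

primrec letter_value :: "'b \<Rightarrow> 'b ^ 'm::finite \<Rightarrow> 'm letter \<Rightarrow> 'b" where
  "letter_value b a Chi0 = b"
| "letter_value b a (Chi r) = a $ r"

primrec eval_word :: "('x \<Rightarrow> 'b) \<Rightarrow> 'x bracketed_word \<Rightarrow> 'b" where
  "eval_word s (Letter x) = s x"
| "eval_word s (Times u v) = mult (eval_word s u) (eval_word s v)"

text \<open>
  The algebra need not have a unit, so the unit monomial \<open>None\<close> has no value in it; it gets the
  dummy value \<open>0\<close>. This is never used: \<open>None\<close> does not occur in an element of degree one in \<open>\<chi>\<^sub>0\<close>.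
\<close>

definition eval_monomial :: "('m letter \<Rightarrow> 'b) \<Rightarrow> 'm free_monomial \<Rightarrow> 'b" where
  "eval_monomial s w = (case w of None \<Rightarrow> 0 | Some u \<Rightarrow> eval_word s u)"

definition substitution_operator :: "('m::finite, 'a) free_algebra \<Rightarrow> 'b ^ 'm \<Rightarrow> 'b \<Rightarrow> 'b" where
  "substitution_operator h a b =
    (\<Sum>w\<in>Poly_Mapping.keys h.
      scale (Poly_Mapping.lookup h w) (eval_monomial (letter_value b a) w))"

definition linear_trace :: "('b \<Rightarrow> 'b) \<Rightarrow> 'a" where
  "linear_trace T = (\<Sum>e\<in>Basis. representation Basis (T e) e)"

definition operator_trace :: "('m::finite, 'a) free_algebra \<Rightarrow> 'b ^ 'm \<Rightarrow> 'a" where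
  "operator_trace h a = linear_trace (substitution_operator h a)"

definition trace_algebra :: "('b ^ 'm::finite \<Rightarrow> 'a) set" where
  "trace_algebra = generated_subalgebra {operator_trace h |h. degree_one_in_Chi0 h}"

end

end

theory Submission
  imports Defs
begin

text \<open>
  Operator traces are polynomial in the coordinates, and an automorphism conjugates the operator
  \<open>b \<mapsto> h(b, a)\<close> into the operator at the transformed point, so one inclusion is the conjugation
  invariance of the trace (\<open>trace_algebra_subset_invariants\<close>).

  For the other inclusion, an automorphism \<open>g \<noteq> id\<close> is brought to diagonal form. A \<open>g\<close> with a
  single eigenvalue would make its eigenline an ideal, contradicting simplicity, so there
  is a basis \<open>u, v\<close> of eigenvectors with distinct eigenvalues \<open>k, l\<close>. A product of eigenvectors lies
  in the eigenspace of the product of the eigenvalues, and this together with simplicity leaves two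
  possibilities. Either one eigenvalue is \<open>1\<close> and the other one \<open>-1\<close>; then
  \<open>u u = c v\<close>, \<open>u v = p u\<close>, \<open>v u = q u\<close>, \<open>v v = d v\<close>. Or \<open>k, l\<close> are the two primitive cube roots of
  unity; then, after scaling, \<open>u u = v\<close>, \<open>v v = u\<close>, \<open>u v = v u = 0\<close>.

  Write \<open>x\<close> and \<open>y\<close> for the coordinates of the arguments. In the first case the polynomials
  invariant under the reflection \<open>u \<mapsto> -u\<close> are generated by all \<open>y\<^sub>r\<close> and all \<open>x\<^sub>r x\<^sub>s\<close>. The operators of
  left and right multiplication have traces \<open>(q + d) y\<^sub>r\<close> and \<open>(p + d) y\<^sub>r\<close>, and traces of products of
  two such operators then give the \<open>x\<^sub>r x\<^sub>s\<close>, unless \<open>p = q = -d\<close>. In that exceptional case both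
  traces vanish identically, but the algebra is then isomorphic to the one of the second case.
  The algebra of the second case has more symmetry: both the rotations by cube roots of unity and
  the swap of \<open>u\<close> and \<open>v\<close>. Their common invariants are generated by \<open>x\<^sub>r y\<^sub>s + y\<^sub>r x\<^sub>s\<close> and
  \<open>x\<^sub>r x\<^sub>s x\<^sub>t + y\<^sub>r y\<^sub>s y\<^sub>t\<close> (\<open>sym_mon_trace\<close>), and these are traces.

  In both cases only invariance under these explicit automorphisms is exploited: averaging over them
  fixes an invariant up to a nonzero factor and sends every monomial into the trace algebra. Since
  traces and polynomiality do not depend on the basis, all of this may be carried out in the basis
  \<open>u, v\<close>.
\<close>

section \<open>Subalgebras of function algebras\<close>

inductive_set linear_hull :: "('t \<Rightarrow> 'a::comm_ring_1) set \<Rightarrow> ('t \<Rightarrow> 'a) set"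
  for M :: "('t \<Rightarrow> 'a) set" where
  base: "f \<in> M \<Longrightarrow> f \<in> linear_hull M"
| smult: "f \<in> linear_hull M \<Longrightarrow> (\<lambda>t. c * f t) \<in> linear_hull M"
| add: "f \<in> linear_hull M \<Longrightarrow> g \<in> linear_hull M \<Longrightarrow> (\<lambda>t. f t + g t) \<in> linear_hull M"

text \<open>
  This replaces writing a polynomial as a combination of monomials: \<open>M\<close> is typically a set of
  products of generators, and a linear averaging operator then only has to be studied on \<open>M\<close>. The
  induction runs over \<open>f\<close>, with the claim that multiplication by \<open>f\<close> preserves the hull, because that
  claim is trivially compatible with products.
\<close>

lemma generated_subalgebra_subset_linear_hull:
  assumes one: "(\<lambda>_. 1) \<in> M"
    and step: "\<And>s m. s \<in> S \<Longrightarrow> m \<in> M \<Longrightarrow> (\<lambda>t. s t * m t) \<in> M"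
  shows "generated_subalgebra S \<subseteq> linear_hull M"
proof
  fix f assume f: "f \<in> generated_subalgebra S"
  have "\<forall>m\<in>linear_hull M. (\<lambda>t. f t * m t) \<in> linear_hull M"
    using f
  proof (induction rule: generated_subalgebra.induct)
    case one
    then show ?case by simp
  next
    case (gen f)
    show ?case
    proof
      fix m assume "m \<in> linear_hull M"
      then show "(\<lambda>t. f t * m t) \<in> linear_hull M"
      proof (induction rule: linear_hull.induct)
        case (base m)
        then show ?case using step[OF gen] by (intro linear_hull.base)
      next
        case (smult m c)
        from linear_hull.smult[OF smult.IH, of c] show ?case
          by (simp add: mult.left_commute)
      next
        case (add m n)
        from linear_hull.add[OF add.IH] show ?case
          by (simp add: distrib_left)
      qed
    qed
  next
    case (smult f c)
    then show ?case
      using linear_hull.smult[of _ M c] by (simp add: mult.assoc)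
  next
    case (add f g)
    then show ?case
      using linear_hull.add[of _ M] by (simp add: distrib_right)
  next
    case (mult f g)
    then show ?case by (simp add: mult.assoc)
  qed
  from bspec[OF this linear_hull.base[OF one]] show "f \<in> linear_hull M" by simp
qed

lemma generated_subalgebra_least:
  assumes "\<And>s. s \<in> S \<Longrightarrow> s \<in> generated_subalgebra S'"
  shows "generated_subalgebra S \<subseteq> generated_subalgebra S'"
proof
  fix f assume "f \<in> generated_subalgebra S"
  then show "f \<in> generated_subalgebra S'"
    by (induction rule: generated_subalgebra.induct)
      (auto intro: assms generated_subalgebra.intros)
qed

lemma generated_subalgebra_const: "(\<lambda>_. c) \<in> generated_subalgebra S"
  using generated_subalgebra.smult[OF generated_subalgebra.one, where c = c] by simp

lemma generated_subalgebra_diff: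
  assumes "f \<in> generated_subalgebra S" "g \<in> generated_subalgebra S"
  shows "(\<lambda>t. f t - g t) \<in> generated_subalgebra S"
  using generated_subalgebra.add[OF assms(1) generated_subalgebra.smult[OF assms(2), where c = "-1"]]
  by simp

lemma generated_subalgebra_sum:
  assumes "\<And>i. i \<in> I \<Longrightarrow> f i \<in> generated_subalgebra S"
  shows "(\<lambda>t. \<Sum>i\<in>I. f i t) \<in> generated_subalgebra S"
  using assms
  by (induction I rule: infinite_finite_induct)
    (auto intro: generated_subalgebra_const generated_subalgebra.add)

section \<open>Operator traces are invariant polynomials\<close>

context nonassoc_algebra
begin

lemma mult_simps:
  "mult (x + y) z = mult x z + mult y z"
  "mult x (y + z) = mult x y + mult x z"
  "mult (scale c x) y = scale c (mult x y)"
  "mult x (scale c y) = scale c (mult x y)"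
  using linear_mult_left linear_mult_right by (auto simp: Vector_Spaces.linear_iff)

lemma mult_zero [simp]: "mult 0 x = 0" "mult x 0 = 0"
  using mult_simps(3)[of 0 0 x] mult_simps(4)[of x 0 0] by auto

lemma linear_simps:
  assumes "Vector_Spaces.linear scale scale T"
  shows "T (x + y) = T x + T y" "T (scale c x) = scale c (T x)"
  using assms by (auto simp: Vector_Spaces.linear_iff)

lemma linearI:
  assumes "\<And>x y. T (x + y) = T x + T y" "\<And>c x. T (scale c x) = scale c (T x)"
  shows "Vector_Spaces.linear scale scale T"
  using assms vector_space_axioms by (auto simp: Vector_Spaces.linear_iff)

lemma linear_sum:
  assumes T: "Vector_Spaces.linear scale scale T"
  shows "T (\<Sum>i\<in>I. scale (c i) (x i)) = (\<Sum>i\<in>I. scale (c i) (T (x i)))"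
proof -
  have "T 0 = 0" using linear_simps(2)[OF T, of 0 0] by simp
  then show ?thesis
    by (induction I rule: infinite_finite_induct) (auto simp: linear_simps[OF T])
qed

lemma basis_expansion:
  assumes "finite C" "independent C" "span C = UNIV"
  shows "(\<Sum>c\<in>C. scale (representation C x c) c) = x"
  using sum_representation_eq[of C x C] assms by auto

lemma representation_linear_combination:
  assumes "independent C" "span C = UNIV"
  shows "representation C (\<Sum>i\<in>I. scale (k i) (x i)) c = (\<Sum>i\<in>I. k i * representation C (x i) c)"
  using assms by (simp add: representation_sum representation_scale)

lemma linear_trace_basis_independent:
  assumes C: "finite C" "independent C" "span C = UNIV"
    and T: "Vector_Spaces.linear scale scale T"
  shows "linear_trace T = (\<Sum>c\<in>C. representation C (T c) c)"
proof -
  have "representation Basis (T e) e = (\<Sum>c\<in>C. representation C (T e) c * representation Basis c e)"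
    for e
    using representation_linear_combination[OF independent_Basis span_Basis,
        where I = C and x = "\<lambda>c. c" and k = "representation C (T e)"] basis_expansion[OF C, of "T e"]
    by simp
  then have "linear_trace T
      = (\<Sum>e\<in>Basis. \<Sum>c\<in>C. representation C (T e) c * representation Basis c e)"
    unfolding linear_trace_def by simp
  also have "\<dots> = (\<Sum>c\<in>C. \<Sum>e\<in>Basis. representation Basis c e * representation C (T e) c)"
    by (subst sum.swap) (simp add: mult.commute)
  also have "\<dots> = (\<Sum>c\<in>C. representation C (T c) c)"
  proof (rule sum.cong[OF refl])
    fix c
    have "T c = (\<Sum>e\<in>Basis. scale (representation Basis c e) (T e))"
      using linear_sum[OF T, where I = Basis and x = "\<lambda>e. e" and c = "representation Basis c"]
        basis_expansion[OF finite_Basis independent_Basis span_Basis, of c] by simp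
    then show "(\<Sum>e\<in>Basis. representation Basis c e * representation C (T e) c)
        = representation C (T c) c"
      using representation_linear_combination[OF C(2,3), where I = Basis] by simp
  qed
  finally show ?thesis .
qed

text \<open>
  In coordinates both sides are the same double sum with the order of summation exchanged.
\<close>

lemma linear_trace_commute:
  assumes S: "Vector_Spaces.linear scale scale S" and T: "Vector_Spaces.linear scale scale T"
  shows "linear_trace (\<lambda>x. S (T x)) = linear_trace (\<lambda>x. T (S x))"
proof -
  let ?r = "representation Basis"
  have *: "linear_trace (\<lambda>x. S (T x)) = (\<Sum>e\<in>Basis. \<Sum>f\<in>Basis. ?r (T e) f * ?r (S f) e)"
    if S: "Vector_Spaces.linear scale scale S" for S T
    unfolding linear_trace_def
  proof (rule sum.cong[OF refl])
    fix e
    have "S (T e) = (\<Sum>f\<in>Basis. scale (?r (T e) f) (S f))"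
      using basis_expansion[OF finite_Basis independent_Basis span_Basis, of "T e"]
        linear_sum[OF S, where I = Basis and x = "\<lambda>e. e" and c = "?r (T e)"] by simp
    then show "?r (S (T e)) e = (\<Sum>f\<in>Basis. ?r (T e) f * ?r (S f) e)"
      by (simp add: representation_linear_combination[OF independent_Basis span_Basis])
  qed
  show ?thesis
    unfolding *[OF S] *[OF T] by (subst sum.swap) (simp add: mult.commute)
qed

lemma linear_inverse:
  assumes g: "Vector_Spaces.linear scale scale g" "bij g"
  shows "Vector_Spaces.linear scale scale (inv g)"
proof (rule linearI)
  have gi: "g (inv g x) = x" "inv g (g x) = x" for x
    using g(2) by (auto simp: bij_def surj_f_inv_f)
  show "inv g (x + y) = inv g x + inv g y" for x y
    using gi linear_simps(1)[OF g(1)] by metis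
  show "inv g (scale c x) = scale c (inv g x)" for c x
    using gi linear_simps(2)[OF g(1)] by metis
qed

lemma linear_trace_conjugate:
  assumes g: "Vector_Spaces.linear scale scale g" "bij g"
    and T: "Vector_Spaces.linear scale scale T"
    and conj: "\<And>x. T' (g x) = g (T x)"
  shows "linear_trace T' = linear_trace T"
proof -
  have gi: "g (inv g x) = x" "inv g (g x) = x" for x
    using g(2) by (auto simp: bij_def surj_f_inv_f)
  have "T' = (\<lambda>x. g (T (inv g x)))"
    using conj gi by metis
  moreover have "Vector_Spaces.linear scale scale (\<lambda>x. T (inv g x))"
    using linear_simps[OF T] linear_simps[OF linear_inverse[OF g]] by (auto intro: linearI)
  ultimately have "linear_trace T' = linear_trace (\<lambda>x. T (inv g (g x)))"
    using linear_trace_commute[OF g(1)] by simp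
  then show ?thesis by (simp add: gi)
qed

lemma eval_word_independent_of_Chi0:
  assumes "word_degree Chi0 w = 0"
  shows "eval_word (letter_value b a) w = eval_word (letter_value b' a) w"
  using assms
proof (induction w)
  case (Letter x)
  then show ?case by (cases x) auto
qed auto

lemma linear_eval_word:
  assumes "word_degree Chi0 w = 1"
  shows "Vector_Spaces.linear scale scale (\<lambda>b. eval_word (letter_value b a) w)"
  using assms
proof (induction w)
  case (Letter x)
  then show ?case by (cases x) (auto intro!: linearI split: if_splits)
next
  case (Times u v)
  then consider "word_degree Chi0 u = 1" "word_degree Chi0 v = 0"
    | "word_degree Chi0 u = 0" "word_degree Chi0 v = 1"
    by (auto simp: add_is_1)
  then show ?case
  proof cases
    case 1
    from eval_word_independent_of_Chi0[OF 1(2)]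
    obtain z where "eval_word (letter_value b a) v = z" for b by metis
    with linear_simps[OF Times.IH(1)[OF 1(1)]] show ?thesis
      by (auto intro!: linearI simp: mult_simps)
  next
    case 2
    from eval_word_independent_of_Chi0[OF 2(1)]
    obtain z where "eval_word (letter_value b a) u = z" for b by metis
    with linear_simps[OF Times.IH(2)[OF 2(2)]] show ?thesis
      by (auto intro!: linearI simp: mult_simps)
  qed
qed

lemma degree_one_monomial:
  assumes "degree_one_in_Chi0 h" "w \<in> Poly_Mapping.keys h"
  obtains u where "w = Some u" "word_degree Chi0 u = 1"
  using assms by (auto simp: degree_one_in_Chi0_def monomial_degree_def split: option.splits)

lemma linear_substitution_operator:
  assumes h: "degree_one_in_Chi0 h"
  shows "Vector_Spaces.linear scale scale (substitution_operator h a)"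
proof -
  have lin: "Vector_Spaces.linear scale scale (\<lambda>b. eval_monomial (letter_value b a) w)"
    if w: "w \<in> Poly_Mapping.keys h" for w
  proof -
    obtain u where "w = Some u" "word_degree Chi0 u = 1" by (rule degree_one_monomial[OF h w])
    then show ?thesis using linear_eval_word[of u a] by (simp add: eval_monomial_def)
  qed
  show ?thesis
  proof (rule linearI)
    show "substitution_operator h a (x + y) = substitution_operator h a x + substitution_operator h a y"
      for x y
      unfolding substitution_operator_def sum.distrib[symmetric]
      by (rule sum.cong[OF refl]) (simp add: linear_simps[OF lin] scale_right_distrib)
    show "substitution_operator h a (scale c x) = scale c (substitution_operator h a x)" for c x
      unfolding substitution_operator_def scale_sum_right
      by (rule sum.cong[OF refl]) (simp add: linear_simps[OF lin] mult.commute)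
  qed
qed

lemma eval_word_automorphism:
  assumes "g \<in> Aut"
  shows "eval_word (letter_value (g b) (\<chi> r. g (a $ r))) w = g (eval_word (letter_value b a) w)"
proof (induction w)
  case (Letter x)
  then show ?case by (cases x) auto
next
  case (Times u v)
  then show ?case using assms by (simp add: Aut_def)
qed

lemma operator_trace_invariant:
  assumes h: "degree_one_in_Chi0 h" and g: "g \<in> Aut"
  shows "operator_trace h (\<chi> r. g (a $ r)) = operator_trace h a"
  unfolding operator_trace_def
proof (rule linear_trace_conjugate)
  show lin: "Vector_Spaces.linear scale scale g" and "bij g"
    using g by (auto simp: Aut_def)
  show "Vector_Spaces.linear scale scale (substitution_operator h a)"
    by (rule linear_substitution_operator[OF h])
  show "substitution_operator h (\<chi> r. g (a $ r)) (g x) = g (substitution_operator h a x)" for x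
    unfolding substitution_operator_def linear_sum[OF lin]
  proof (rule sum.cong[OF refl])
    fix w assume "w \<in> Poly_Mapping.keys h"
    then obtain u where "w = Some u" by (rule degree_one_monomial[OF h])
    then show "scale (Poly_Mapping.lookup h w) (eval_monomial (letter_value (g x) (\<chi> r. g (a $ r))) w) =
      scale (Poly_Mapping.lookup h w) (g (eval_monomial (letter_value x a) w))"
      by (simp add: eval_monomial_def eval_word_automorphism[OF g])
  qed
qed

text \<open>
  Structure constants: coordinates of a product are bilinear in the coordinates of the factors, so
  by induction every bracketed word has polynomial coordinates.
\<close>

lemma representation_mult:
  "representation Basis (mult x y) e =
    (\<Sum>i\<in>Basis. \<Sum>j\<in>Basis. representation Basis x i * (representation Basis y j *
      representation Basis (mult i j) e))"
proof -
  let ?r = "representation Basis"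
  note expand = basis_expansion[OF finite_Basis independent_Basis span_Basis]
  note comb = representation_linear_combination[OF independent_Basis span_Basis]
  have "mult x y = (\<Sum>i\<in>Basis. scale (?r x i) (mult i y))"
    using linear_sum[OF linear_mult_left[of y], where I = Basis and x = "\<lambda>e. e" and c = "?r x"]
    by (simp add: expand)
  moreover have "mult i y = (\<Sum>j\<in>Basis. scale (?r y j) (mult i j))" for i
    using linear_sum[OF linear_mult_right[of i], where I = Basis and x = "\<lambda>e. e" and c = "?r y"]
    by (simp add: expand)
  ultimately show ?thesis
    by (simp add: comb sum_distrib_left)
qed

lemma eval_word_polynomial:
  assumes "e \<in> Basis"
  shows "(\<lambda>a. representation Basis (eval_word (letter_value b a) w) e) \<in> polynomial_functions"
  using assms
proof (induction w arbitrary: e)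
  case (Letter x)
  show ?case
  proof (cases x)
    case Chi0
    then show ?thesis
      by (simp add: polynomial_functions_def generated_subalgebra_const)
  next
    case (Chi r)
    have "coordinate r e \<in> generated_subalgebra {coordinate r e |r e. e \<in> Basis}"
      by (rule generated_subalgebra.gen) (use Letter in blast)
    moreover have "coordinate r e = (\<lambda>a. representation Basis (a $ r) e)"
      by (auto simp: coordinate_def)
    ultimately show ?thesis
      using Chi by (simp add: polynomial_functions_def)
  qed
next
  case (Times u v)
  let ?r = "representation Basis" and ?s = "letter_value b"
  have "(\<lambda>a. ?r (eval_word (?s a) (Times u v)) e) = (\<lambda>a. \<Sum>i\<in>Basis. \<Sum>j\<in>Basis.
      ?r (eval_word (?s a) u) i * (?r (eval_word (?s a) v) j * ?r (mult i j) e))"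
    by (rule ext) (simp only: eval_word.simps representation_mult[of "eval_word _ u"])
  also have "\<dots> \<in> polynomial_functions"
    using Times.IH unfolding polynomial_functions_def
    by (intro generated_subalgebra_sum generated_subalgebra.mult generated_subalgebra_const) auto
  finally show ?case .
qed

lemma operator_trace_polynomial:
  assumes h: "degree_one_in_Chi0 h"
  shows "operator_trace h \<in> polynomial_functions"
proof -
  let ?r = "representation Basis"
  have "operator_trace h = (\<lambda>a. \<Sum>e\<in>Basis. \<Sum>w\<in>Poly_Mapping.keys h.
      Poly_Mapping.lookup h w * ?r (eval_monomial (letter_value e a) w) e)"
    by (auto simp: operator_trace_def linear_trace_def substitution_operator_def
        representation_linear_combination[OF independent_Basis span_Basis])
  also have "\<dots> \<in> polynomial_functions"
    unfolding polynomial_functions_def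
  proof (intro generated_subalgebra_sum generated_subalgebra.smult)
    fix e w assume e: "e \<in> Basis" and "w \<in> Poly_Mapping.keys h"
    then obtain u where "w = Some u" using degree_one_monomial[OF h] by metis
    then show "(\<lambda>a. ?r (eval_monomial (letter_value e a) w) e)
        \<in> generated_subalgebra {coordinate r e |r e. e \<in> Basis}"
      using eval_word_polynomial[OF e] by (simp add: eval_monomial_def polynomial_functions_def)
  qed
  finally show ?thesis .
qed

lemma trace_algebra_subset_invariants: "trace_algebra \<subseteq> invariants"
proof
  fix f :: "'b ^ 'm::finite \<Rightarrow> 'a" assume f: "f \<in> trace_algebra"
  have "(trace_algebra :: ('b ^ 'm \<Rightarrow> 'a) set) \<subseteq> polynomial_functions"
    unfolding trace_algebra_def polynomial_functions_def
    by (rule generated_subalgebra_least)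
      (auto simp: operator_trace_polynomial[unfolded polynomial_functions_def])
  with f have "f \<in> polynomial_functions" by blast
  moreover have "f (\<chi> r. g (a $ r)) = f a" if g: "g \<in> Aut" for g a
    using f unfolding trace_algebra_def
    by (induction rule: generated_subalgebra.induct) (auto simp: operator_trace_invariant g)
  ultimately show "f \<in> invariants" by (simp add: invariants_def)
qed

text \<open>
  A single bracketed word with coefficient \<open>1\<close> is all that is ever needed to exhibit a function as an
  operator trace.
\<close>

lemma word_trace_in_trace_algebra:
  assumes "word_degree Chi0 w = 1"
  shows "(\<lambda>a. linear_trace (\<lambda>b. eval_word (letter_value b a) w)) \<in> trace_algebra"
proof -
  let ?h = "Poly_Mapping.single (Some w) (1::'a)"
  have "degree_one_in_Chi0 ?h"
    using assms by (simp add: degree_one_in_Chi0_def monomial_degree_def)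
  then have "operator_trace ?h \<in> trace_algebra"
    unfolding trace_algebra_def by (blast intro: generated_subalgebra.gen)
  moreover have "operator_trace ?h = (\<lambda>a. linear_trace (\<lambda>b. eval_word (letter_value b a) w))"
    by (rule ext) (simp add: operator_trace_def substitution_operator_def[abs_def] eval_monomial_def)
  ultimately show ?thesis by simp
qed

lemma polynomial_functions_basis_independent:
  assumes C: "nonassoc_algebra scale C mult"
  shows "(polynomial_functions :: ('b ^ 'm::finite \<Rightarrow> 'a) set)
    \<subseteq> nonassoc_algebra.polynomial_functions scale C"
proof -
  interpret C: nonassoc_algebra scale C mult by fact
  have "coordinate r e \<in> C.polynomial_functions" for r :: 'm and e
  proof -
    have "coordinate r e = (\<lambda>a. \<Sum>c\<in>C. representation Basis c e * C.coordinate r c a)"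
    proof
      fix a :: "'b ^ 'm"
      have "a $ r = (\<Sum>c\<in>C. scale (representation C (a $ r) c) c)"
        by (simp add: basis_expansion C.finite_Basis C.independent_Basis C.span_Basis)
      then show "coordinate r e a = (\<Sum>c\<in>C. representation Basis c e * C.coordinate r c a)"
        unfolding coordinate_def C.coordinate_def
        using representation_linear_combination[OF independent_Basis span_Basis,
            where I = C and x = "\<lambda>c. c" and k = "representation C (a $ r)"]
        by (simp add: mult.commute)
    qed
    also have "\<dots> \<in> C.polynomial_functions"
      unfolding C.polynomial_functions_def
      by (intro generated_subalgebra_sum generated_subalgebra.smult generated_subalgebra.gen) blast
    finally show ?thesis .
  qed
  then show ?thesis
    unfolding polynomial_functions_def C.polynomial_functions_def
    by (intro generated_subalgebra_least) auto
qed

lemma trace_algebra_basis_independent: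
  assumes C: "nonassoc_algebra scale C mult"
  shows "(trace_algebra :: ('b ^ 'm::finite \<Rightarrow> 'a) set) = nonassoc_algebra.trace_algebra scale C mult"
proof -
  interpret C: nonassoc_algebra scale C mult by fact
  have "operator_trace h a = C.operator_trace h a"
    if "degree_one_in_Chi0 h" for h :: "('m, 'a) free_algebra" and a :: "'b ^ 'm"
    unfolding operator_trace_def C.operator_trace_def C.linear_trace_def
    by (rule linear_trace_basis_independent[OF C.finite_Basis C.independent_Basis C.span_Basis
          linear_substitution_operator[OF that]])
  then have "{operator_trace h |h. degree_one_in_Chi0 h}
      = {C.operator_trace h |h :: ('m, 'a) free_algebra. degree_one_in_Chi0 h}"
    by (intro Collect_cong ex_cong1) (auto simp: fun_eq_iff)
  then show ?thesis by (simp add: trace_algebra_def C.trace_algebra_def)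
qed

end

lemma invariants_basis_independent:
  fixes scale :: "'a::field \<Rightarrow> 'b::ab_group_add \<Rightarrow> 'b" and mult :: "'b \<Rightarrow> 'b \<Rightarrow> 'b"
  assumes B: "nonassoc_algebra scale B mult" and C: "nonassoc_algebra scale C mult"
  shows "(nonassoc_algebra.invariants scale B mult :: ('b ^ 'm::finite \<Rightarrow> 'a) set)
    = nonassoc_algebra.invariants scale C mult"
  unfolding nonassoc_algebra.invariants_def[OF B] nonassoc_algebra.invariants_def[OF C]
  using nonassoc_algebra.polynomial_functions_basis_independent[OF B C]
    nonassoc_algebra.polynomial_functions_basis_independent[OF C B] by blast

section \<open>Coordinates in two-dimensional algebras\<close>

locale planar_algebra = nonassoc_algebra scale "{u, v}" mult
  for scale :: "'a::field \<Rightarrow> 'b::ab_group_add \<Rightarrow> 'b" and u v mult +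
  assumes u_neq_v: "u \<noteq> v"
begin

definition xc :: "'b \<Rightarrow> 'a" where "xc z = representation {u, v} z u"
definition yc :: "'b \<Rightarrow> 'a" where "yc z = representation {u, v} z v"

lemma coords_add [simp]: "xc (z + z') = xc z + xc z'" "yc (z + z') = yc z + yc z'"
  by (simp_all add: xc_def yc_def representation_add independent_Basis span_Basis)

lemma coords_scale [simp]: "xc (scale k z) = k * xc z" "yc (scale k z) = k * yc z"
  by (simp_all add: xc_def yc_def representation_scale independent_Basis span_Basis)

lemma coords_diff [simp]: "xc (z - z') = xc z - xc z'" "yc (z - z') = yc z - yc z'"
  by (simp_all add: xc_def yc_def representation_diff independent_Basis span_Basis)

lemma coords_zero [simp]: "xc 0 = 0" "yc 0 = 0"
  by (simp_all add: xc_def yc_def representation_zero)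

lemma coords_basis [simp]: "xc u = 1" "yc u = 0" "xc v = 0" "yc v = 1"
  using u_neq_v by (auto simp: xc_def yc_def representation_basis independent_Basis)

lemma coords_minus [simp]: "xc (- z) = - xc z" "yc (- z) = - yc z"
  using coords_diff[of 0 z] by simp_all

lemma basis_nonzero [simp]: "u \<noteq> 0" "v \<noteq> 0"
  using coords_basis(1,4) coords_zero by force+

lemma decompose: "z = scale (xc z) u + scale (yc z) v"
  using basis_expansion[OF finite_Basis independent_Basis span_Basis, of z] u_neq_v
  by (simp add: xc_def yc_def)

lemma coords_eqI: "xc z = xc z' \<Longrightarrow> yc z = yc z' \<Longrightarrow> z = z'"
  using decompose by metis

lemma linear_trace_coords: "linear_trace T = xc (T u) + yc (T v)"
  using u_neq_v by (simp add: linear_trace_def xc_def yc_def)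

text \<open>
  The coordinates of \<open>u u\<close>, \<open>u v\<close>, \<open>v u\<close>, \<open>v v\<close> on the right are structure constants; these equations
  rewrite themselves and therefore are always instantiated before use.
\<close>

lemma coords_mult:
  "xc (mult z z') = xc z * xc z' * xc (mult u u) + xc z * yc z' * xc (mult u v)
    + yc z * xc z' * xc (mult v u) + yc z * yc z' * xc (mult v v)"
  "yc (mult z z') = xc z * xc z' * yc (mult u u) + xc z * yc z' * yc (mult u v)
    + yc z * xc z' * yc (mult v u) + yc z * yc z' * yc (mult v v)"
proof -
  have "mult z z' = mult (scale (xc z) u + scale (yc z) v) (scale (xc z') u + scale (yc z') v)"
    using decompose by metis
  then have *: "mult z z' = scale (xc z * xc z') (mult u u) + scale (xc z * yc z') (mult u v)
    + scale (yc z * xc z') (mult v u) + scale (yc z * yc z') (mult v v)"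
    by (simp add: mult_simps scale_right_distrib algebra_simps)
  show "xc (mult z z') = xc z * xc z' * xc (mult u u) + xc z * yc z' * xc (mult u v)
    + yc z * xc z' * xc (mult v u) + yc z * yc z' * xc (mult v v)"
    "yc (mult z z') = xc z * xc z' * yc (mult u u) + xc z * yc z' * yc (mult u v)
    + yc z * xc z' * yc (mult v u) + yc z * yc z' * yc (mult v v)"
    unfolding * by simp_all
qed

lemma coords_linear:
  assumes "Vector_Spaces.linear scale scale g"
  shows "xc (g z) = xc z * xc (g u) + yc z * xc (g v)"
    and "yc (g z) = xc z * yc (g u) + yc z * yc (g v)"
proof -
  have "g z = g (scale (xc z) u + scale (yc z) v)"
    using decompose by metis
  then have "g z = scale (xc z) (g u) + scale (yc z) (g v)"
    using linear_simps[OF assms] by simp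
  then show "xc (g z) = xc z * xc (g u) + yc z * xc (g v)"
    and "yc (g z) = xc z * yc (g u) + yc z * yc (g v)" by simp_all
qed

lemma basis_change:
  assumes det: "xc p * yc q \<noteq> yc p * xc q"
  shows "planar_algebra scale p q mult"
proof -
  have p: "p \<noteq> 0" and pq: "p \<noteq> q" using det by (auto simp: mult.commute)
  have "q \<notin> span {p}"
    using det by (auto simp: span_singleton algebra_simps)
  then have "q \<notin> span {p}" "independent {p}" using p by auto
  then have ind: "independent {p, q}"
    using independent_insertI[of q "{p}"] by (simp add: insert_commute)
  have "dim UNIV = 2"
    using dim_eq_card[of "{u, v}" UNIV] u_neq_v by (simp add: span_Basis independent_Basis)
  then have "UNIV \<subseteq> span {p, q}"
    using pq ind by (intro card_ge_dim_independent) auto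
  then have "span {p, q} = UNIV" by auto
  with ind pq show ?thesis
    by (intro planar_algebra.intro planar_algebra_axioms.intro nonassoc_algebra.intro
        nonassoc_algebra_axioms.intro finite_dimensional_vector_space.intro
        finite_dimensional_vector_space_axioms.intro vector_space_axioms
        linear_mult_left linear_mult_right) auto
qed

text \<open>
  Bijectivity comes from Cramer's rule.
\<close>

lemma automorphismI:
  assumes g: "Vector_Spaces.linear scale scale g"
    and det: "xc (g u) * yc (g v) \<noteq> yc (g u) * xc (g v)"
    and products: "\<And>x y. g (mult x y) = mult (g x) (g y)"
  shows "g \<in> Aut"
proof -
  let ?d = "xc (g u) * yc (g v) - yc (g u) * xc (g v)"
  have d: "?d \<noteq> 0" using det by simp
  have "inj g"
  proof (rule injI)
    fix x y assume "g x = g y"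
    then have "xc x * xc (g u) + yc x * xc (g v) = xc y * xc (g u) + yc y * xc (g v)"
      "xc x * yc (g u) + yc x * yc (g v) = xc y * yc (g u) + yc y * yc (g v)"
      using coords_linear[OF g] by metis+
    then have "(xc x - xc y) * ?d = 0" "(yc x - yc y) * ?d = 0"
      by algebra+
    with d show "x = y" by (intro coords_eqI) auto
  qed
  moreover have "surj g"
  proof (rule surjI)
    fix z
    show "g (scale ((xc z * yc (g v) - yc z * xc (g v)) / ?d) u
      + scale ((yc z * xc (g u) - xc z * yc (g u)) / ?d) v) = z" (is "g ?w = z")
    proof (rule coords_eqI)
      have "(xc z * yc (g v) - yc z * xc (g v)) * xc (g u)
        + (yc z * xc (g u) - xc z * yc (g u)) * xc (g v) = xc z * ?d" by algebra
      then show "xc (g ?w) = xc z" unfolding coords_linear[OF g, of ?w] using d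
        by (simp add: add_divide_distrib[symmetric] nonzero_divide_eq_eq)
      have "(xc z * yc (g v) - yc z * xc (g v)) * yc (g u)
        + (yc z * xc (g u) - xc z * yc (g u)) * yc (g v) = yc z * ?d" by algebra
      then show "yc (g ?w) = yc z" unfolding coords_linear[OF g, of ?w] using d
        by (simp add: add_divide_distrib[symmetric] nonzero_divide_eq_eq)
    qed
  qed
  ultimately show ?thesis using g products by (auto simp: Aut_def bij_def)
qed

lemma polynomial_functions_coords:
  "(polynomial_functions :: ('b ^ 'm::finite \<Rightarrow> 'a) set)
    = generated_subalgebra (range (\<lambda>r a. xc (a $ r)) \<union> range (\<lambda>r a. yc (a $ r)))"
proof -
  have "{coordinate r e |(r::'m) e. e \<in> {u, v}}
      = range (\<lambda>r a. xc (a $ r)) \<union> range (\<lambda>r a. yc (a $ r))"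
    by (auto simp: coordinate_def[abs_def] xc_def yc_def)
  then show ?thesis unfolding polynomial_functions_def by simp
qed

text \<open>
  Otherwise the line through \<open>u\<close> would be a two-sided ideal.
\<close>

lemma simple_line_not_ideal:
  assumes simple
  shows "yc (mult u u) \<noteq> 0 \<or> yc (mult u v) \<noteq> 0 \<or> yc (mult v u) \<noteq> 0"
proof (rule ccontr)
  assume "\<not> ?thesis"
  then have "yc (mult a x) = 0" "yc (mult x a) = 0" if "yc x = 0" for a x
    using that coords_mult(2)[of a x] coords_mult(2)[of x a] by simp_all
  then have "two_sided_ideal {z. yc z = 0}"
    by (simp add: two_sided_ideal_def subspace_def)
  then have "{z. yc z = 0} = {0} \<or> {z. yc z = 0} = UNIV"
    using assms by (simp add: simple_def)
  moreover have "u \<noteq> 0" by simp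
  moreover have "u \<in> {z. yc z = 0}" "v \<notin> {z. yc z = 0}" by simp_all
  ultimately show False by blast
qed

lemma simple_lines_not_ideals:
  assumes simple
  shows "yc (mult u u) \<noteq> 0 \<or> yc (mult u v) \<noteq> 0 \<or> yc (mult v u) \<noteq> 0"
    and "xc (mult v v) \<noteq> 0 \<or> xc (mult v u) \<noteq> 0 \<or> xc (mult u v) \<noteq> 0"
proof -
  interpret swapped: planar_algebra scale v u mult by (rule basis_change) simp
  have "swapped.yc z = xc z" for z by (simp add: swapped.yc_def xc_def insert_commute)
  then show "yc (mult u u) \<noteq> 0 \<or> yc (mult u v) \<noteq> 0 \<or> yc (mult v u) \<noteq> 0"
    and "xc (mult v v) \<noteq> 0 \<or> xc (mult v u) \<noteq> 0 \<or> xc (mult u v) \<noteq> 0"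
    using simple_line_not_ideal[OF assms] swapped.simple_line_not_ideal[OF assms] by simp_all
qed

end

section \<open>Algebras with a reflection\<close>

text \<open>
  The assumption \<open>trace_nonzero\<close> says that the trace of left or of right multiplication by \<open>v\<close> is
  nonzero. Otherwise \<open>p = q = -d\<close>, and over an algebraically closed field there are automorphisms
  that do not preserve \<open>y\<close>, so that \<open>y\<close> cannot be a trace.
\<close>

locale reflection_algebra = planar_algebra scale u v mult
  for scale :: "'a::field_char_0 \<Rightarrow> 'b::ab_group_add \<Rightarrow> 'b" and u v mult +
  fixes c p q d :: 'a
  assumes uu: "mult u u = scale c v" and uv: "mult u v = scale p u"
    and vu: "mult v u = scale q u" and vv: "mult v v = scale d v"
    and c_nonzero: "c \<noteq> 0" and pq_nonzero: "p \<noteq> 0 \<or> q \<noteq> 0"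
    and trace_nonzero: "q + d \<noteq> 0 \<or> p + d \<noteq> 0"
begin

lemma xc_mult: "xc (mult z z') = p * (xc z * yc z') + q * (yc z * xc z')"
  and yc_mult: "yc (mult z z') = c * (xc z * xc z') + d * (yc z * yc z')"
  using coords_mult[of z z'] by (simp_all add: uu uv vu vv mult_ac)

definition reflection :: "'b \<Rightarrow> 'b" where
  "reflection z = scale (- xc z) u + scale (yc z) v"

lemma coords_reflection [simp]: "xc (reflection z) = - xc z" "yc (reflection z) = yc z"
  by (simp_all add: reflection_def)

lemma reflection_automorphism: "reflection \<in> Aut"
proof (rule automorphismI)
  show "Vector_Spaces.linear scale scale reflection"
    by (rule linearI; rule coords_eqI) simp_all
  show "reflection (mult x y) = mult (reflection x) (reflection y)" for x y
    by (rule coords_eqI) (simp_all add: xc_mult yc_mult)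
qed simp

text \<open>
  Left and right multiplication by \<open>x u + y v\<close> have traces \<open>(q + d) y\<close> and \<open>(p + d) y\<close>.
\<close>

lemma yc_trace: "(\<lambda>a. yc (a $ r)) \<in> trace_algebra"
proof -
  have "(\<lambda>a. (q + d) * yc (a $ r)) \<in> trace_algebra"
    using word_trace_in_trace_algebra[of "Times (Letter (Chi r)) (Letter Chi0)"]
    by (simp add: linear_trace_coords xc_mult yc_mult distrib_right)
  then have l: "(\<lambda>a. k * ((q + d) * yc (a $ r))) \<in> trace_algebra" for k
    unfolding trace_algebra_def by (rule generated_subalgebra.smult)
  have "(\<lambda>a. (p + d) * yc (a $ r)) \<in> trace_algebra"
    using word_trace_in_trace_algebra[of "Times (Letter Chi0) (Letter (Chi r))"]
    by (simp add: linear_trace_coords xc_mult yc_mult distrib_right)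
  then have r: "(\<lambda>a. k * ((p + d) * yc (a $ r))) \<in> trace_algebra" for k
    unfolding trace_algebra_def by (rule generated_subalgebra.smult)
  show ?thesis
    using trace_nonzero l[of "1 / (q + d)"] r[of "1 / (p + d)"] by auto
qed

text \<open>
  A product of two left multiplications has trace \<open>2 c p x\<^sub>r x\<^sub>s + (q\<^sup>2 + d\<^sup>2) y\<^sub>r y\<^sub>s\<close>, and for right
  multiplications \<open>p\<close> and \<open>q\<close> change places. One of \<open>p\<close>, \<open>q\<close> is nonzero.
\<close>

lemma xc_xc_trace: "(\<lambda>a. xc (a $ r) * xc (a $ s)) \<in> trace_algebra"
proof -
  let ?X = "\<lambda>a. xc (a $ r) * xc (a $ s)" and ?Y = "\<lambda>a. yc (a $ r) * yc (a $ s)"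
  have Y: "(\<lambda>a. k * ?Y a) \<in> trace_algebra" for k
    using yc_trace unfolding trace_algebra_def
    by (intro generated_subalgebra.smult generated_subalgebra.mult)
  have "(\<lambda>a. 2 * c * p * ?X a + (q * q + d * d) * ?Y a) \<in> trace_algebra"
    using word_trace_in_trace_algebra[of "Times (Letter (Chi r)) (Times (Letter (Chi s)) (Letter Chi0))"]
    by (simp add: linear_trace_coords xc_mult yc_mult algebra_simps)
  from generated_subalgebra_diff[OF this[unfolded trace_algebra_def] Y[of "q * q + d * d", unfolded trace_algebra_def]]
  have "(\<lambda>a. 2 * c * p * ?X a) \<in> trace_algebra"
    unfolding trace_algebra_def by simp
  then have l: "(\<lambda>a. k * (2 * c * p * ?X a)) \<in> trace_algebra" for k
    unfolding trace_algebra_def by (rule generated_subalgebra.smult)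
  have "(\<lambda>a. 2 * c * q * ?X a + (p * p + d * d) * ?Y a) \<in> trace_algebra"
    using word_trace_in_trace_algebra[of "Times (Times (Letter Chi0) (Letter (Chi s))) (Letter (Chi r))"]
    by (simp add: linear_trace_coords xc_mult yc_mult algebra_simps)
  from generated_subalgebra_diff[OF this[unfolded trace_algebra_def] Y[of "p * p + d * d", unfolded trace_algebra_def]]
  have "(\<lambda>a. 2 * c * q * ?X a) \<in> trace_algebra"
    unfolding trace_algebra_def by simp
  then have r: "(\<lambda>a. k * (2 * c * q * ?X a)) \<in> trace_algebra" for k
    unfolding trace_algebra_def by (rule generated_subalgebra.smult)
  show ?thesis
    using pq_nonzero c_nonzero l[of "1 / (2 * c * p)"] r[of "1 / (2 * c * q)"] by auto
qed

text \<open>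
  A monomial is even or odd under the reflection, according to the number of its \<open>x\<close> factors. The
  average over the reflection kills the odd monomials, and an even one is a product of factors
  \<open>x\<^sub>r x\<^sub>s\<close> and \<open>y\<^sub>r\<close>.
\<close>

lemma invariants_subset_trace_algebra: "invariants \<subseteq> trace_algebra"
proof
  fix f :: "'b ^ 'm::finite \<Rightarrow> 'a" assume f: "f \<in> invariants"
  let ?\<tau> = "\<lambda>a :: 'b ^ 'm. \<chi> r. reflection (a $ r)"
  \<comment> \<open>For odd elements it is recorded that one further factor \<open>x\<^sub>r\<close> leads into the trace algebra;
    this makes the set closed under multiplication by every coordinate.\<close>
  define M :: "('b ^ 'm \<Rightarrow> 'a) set" where
    "M = {h. (\<forall>a. h (?\<tau> a) = h a) \<and> h \<in> trace_algebra}
       \<union> {h. (\<forall>a. h (?\<tau> a) = - h a) \<and> (\<forall>r. (\<lambda>a. xc (a $ r) * h a) \<in> trace_algebra)}"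
  have "(polynomial_functions :: ('b ^ 'm \<Rightarrow> 'a) set) \<subseteq> linear_hull M"
    unfolding polynomial_functions_coords
  proof (rule generated_subalgebra_subset_linear_hull)
    show "(\<lambda>_. 1) \<in> M"
      by (simp add: M_def trace_algebra_def generated_subalgebra.one)
    fix s h :: "'b ^ 'm \<Rightarrow> 'a"
    assume s: "s \<in> range (\<lambda>r a. xc (a $ r)) \<union> range (\<lambda>r a. yc (a $ r))" and h: "h \<in> M"
    note mult = generated_subalgebra.mult[of _ "{operator_trace h |h. degree_one_in_Chi0 h}",
        folded trace_algebra_def]
    from s show "(\<lambda>a. s a * h a) \<in> M"
    proof
      assume "s \<in> range (\<lambda>r a. xc (a $ r))"
      then obtain r where s: "s = (\<lambda>a. xc (a $ r))" by auto
      from h mult[OF xc_xc_trace] show ?thesis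
        unfolding M_def s by (auto simp: mult.assoc)
    next
      assume "s \<in> range (\<lambda>r a. yc (a $ r))"
      then obtain r where s: "s = (\<lambda>a. yc (a $ r))" by auto
      have "(\<lambda>a. xc (a $ r') * (yc (a $ r) * h a)) \<in> trace_algebra"
        if "(\<lambda>a. xc (a $ r') * h a) \<in> trace_algebra" for r'
        using mult[OF yc_trace that] by (simp add: mult.left_commute)
      with h mult[OF yc_trace] show ?thesis
        unfolding M_def s by auto
    qed
  qed
  then have "f \<in> linear_hull M" using f by (auto simp: invariants_def)
  then have "(\<lambda>a. f a + f (?\<tau> a)) \<in> trace_algebra"
  proof (induction rule: linear_hull.induct)
    case (base h)
    then show ?case
      using generated_subalgebra_const[of 0] generated_subalgebra.add[of h _ h]
      by (auto simp: M_def trace_algebra_def)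
  next
    case (smult h k)
    then show ?case
      using generated_subalgebra.smult[where c = k]
      by (fastforce simp: trace_algebra_def distrib_left)
  next
    case (add h h')
    then show ?case
      using generated_subalgebra.add[OF add.IH[unfolded trace_algebra_def]]
      by (simp add: trace_algebra_def algebra_simps)
  qed
  moreover have "f (?\<tau> a) = f a" for a
    using f reflection_automorphism by (simp add: invariants_def)
  ultimately have "(\<lambda>a. f a + f a) \<in> trace_algebra" by simp
  then have "(\<lambda>a. (1/2) * (f a + f a)) \<in> trace_algebra"
    unfolding trace_algebra_def by (rule generated_subalgebra.smult)
  then show "f \<in> trace_algebra" by simp
qed

end

section \<open>The algebra with automorphism group of order six\<close>

text \<open>
  This algebra has three nonzero idempotents \<open>\<zeta> u + \<zeta>\<^sup>2 v\<close> with \<open>\<zeta>\<^sup>3 = 1\<close>, and its automorphisms permute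
  them; the six rotations and swapped rotations below realise all permutations.
\<close>

locale cubic_algebra = planar_algebra scale u v mult
  for scale :: "'a::field_char_0 \<Rightarrow> 'b::ab_group_add \<Rightarrow> 'b" and u v mult +
  fixes \<omega> :: 'a
  assumes uu: "mult u u = v" and uv: "mult u v = 0" and vu: "mult v u = 0" and vv: "mult v v = u"
    and omega_cubed: "\<omega> ^ 3 = 1" and omega_neq_1: "\<omega> \<noteq> 1"
begin

lemma xc_mult [simp]: "xc (mult z z') = yc z * yc z'"
  and yc_mult [simp]: "yc (mult z z') = xc z * xc z'"
  using coords_mult[of z z'] by (simp_all add: uu uv vu vv)

definition rotation :: "'a \<Rightarrow> 'b \<Rightarrow> 'b" where
  "rotation \<zeta> z = scale (\<zeta> * xc z) u + scale (\<zeta>\<^sup>2 * yc z) v"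

definition swap_rotation :: "'a \<Rightarrow> 'b \<Rightarrow> 'b" where
  "swap_rotation \<zeta> z = scale (\<zeta> * yc z) u + scale (\<zeta>\<^sup>2 * xc z) v"

lemma coords_rotation [simp]:
  "xc (rotation \<zeta> z) = \<zeta> * xc z" "yc (rotation \<zeta> z) = \<zeta>\<^sup>2 * yc z"
  "xc (swap_rotation \<zeta> z) = \<zeta> * yc z" "yc (swap_rotation \<zeta> z) = \<zeta>\<^sup>2 * xc z"
  by (simp_all add: rotation_def swap_rotation_def)

lemma rotation_automorphism:
  assumes "\<zeta> ^ 3 = 1"
  shows "rotation \<zeta> \<in> Aut" "swap_rotation \<zeta> \<in> Aut"
proof -
  have z: "\<zeta> \<noteq> 0" "\<zeta>\<^sup>2 * \<zeta>\<^sup>2 = \<zeta>" using assms by (auto simp: algebra_simps power2_eq_square power3_eq_cube)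
  have z4: "\<zeta>\<^sup>2 * x * (\<zeta>\<^sup>2 * y) = \<zeta> * (x * y)" for x y
  proof -
    have "\<zeta>\<^sup>2 * x * (\<zeta>\<^sup>2 * y) = (\<zeta>\<^sup>2 * \<zeta>\<^sup>2) * (x * y)" by (simp only: mult_ac)
    then show ?thesis by (simp only: z(2))
  qed
  show "rotation \<zeta> \<in> Aut"
  proof (rule automorphismI)
    show "Vector_Spaces.linear scale scale (rotation \<zeta>)"
      by (rule linearI; rule coords_eqI) (simp_all add: algebra_simps)
    show "rotation \<zeta> (mult x y) = mult (rotation \<zeta> x) (rotation \<zeta> y)" for x y
      by (rule coords_eqI) (simp_all add: z4, simp add: power2_eq_square mult_ac)
  qed (use z in auto)
  show "swap_rotation \<zeta> \<in> Aut"
  proof (rule automorphismI)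
    show "Vector_Spaces.linear scale scale (swap_rotation \<zeta>)"
      by (rule linearI; rule coords_eqI) (simp_all add: algebra_simps)
    show "swap_rotation \<zeta> (mult x y) = mult (swap_rotation \<zeta> x) (swap_rotation \<zeta> y)" for x y
      by (rule coords_eqI) (simp_all add: z4, simp add: power2_eq_square mult_ac)
  qed (use z in auto)
qed

text \<open>
  Monomials are indexed by lists rather than multisets, so that generators can be split off by
  pattern matching; the order of the entries does not affect the value.
\<close>

definition mon :: "'m list \<Rightarrow> 'm list \<Rightarrow> 'b ^ 'm::finite \<Rightarrow> 'a" where
  "mon R S a = prod_list (map (\<lambda>r. xc (a $ r)) R) * prod_list (map (\<lambda>s. yc (a $ s)) S)"

lemma mon_Nil [simp]: "mon [] [] a = 1"
  and mon_Cons_left [simp]: "mon (r # R) S a = xc (a $ r) * mon R S a"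
  and mon_Cons_right [simp]: "mon R (s # S) a = yc (a $ s) * mon R S a"
  by (simp_all add: mon_def mult_ac)

lemma mon_rotation:
  fixes a :: "'b ^ 'm::finite"
  shows "mon R S (\<chi> r. rotation \<zeta> (a $ r)) = \<zeta> ^ (length R + 2 * length S) * mon R S a"
  "mon R S (\<chi> r. swap_rotation \<zeta> (a $ r)) = \<zeta> ^ (length R + 2 * length S) * mon S R a"
proof -
  have "prod_list (map (\<lambda>r. k * h r) R) = k ^ length R * prod_list (map h R)"
    for k :: 'a and h :: "'m \<Rightarrow> 'a" and R
    by (induction R) (auto simp: mult_ac)
  then show "mon R S (\<chi> r. rotation \<zeta> (a $ r)) = \<zeta> ^ (length R + 2 * length S) * mon R S a"
    "mon R S (\<chi> r. swap_rotation \<zeta> (a $ r)) = \<zeta> ^ (length R + 2 * length S) * mon S R a"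
    by (simp_all add: mon_def power_add power_mult[symmetric] mult_ac)
qed

definition sym_mon :: "'m list \<Rightarrow> 'm list \<Rightarrow> 'b ^ 'm::finite \<Rightarrow> 'a" where
  "sym_mon R S a = mon R S a + mon S R a"

lemma sym_mon_commute: "sym_mon R S = sym_mon S R"
  by (auto simp: sym_mon_def)

lemma sym_mon_2_trace: "sym_mon [r] [s] \<in> trace_algebra"
proof -
  have "sym_mon [r] [s] = (\<lambda>a. linear_trace (\<lambda>b. eval_word (letter_value b a)
      (Times (Letter (Chi r)) (Times (Letter (Chi s)) (Letter Chi0)))))"
    by (auto simp: sym_mon_def linear_trace_coords mult_ac)
  also have "\<dots> \<in> trace_algebra" by (rule word_trace_in_trace_algebra) simp
  finally show ?thesis .
qed

lemma sym_mon_3_trace: "sym_mon [r, s, t] [] \<in> trace_algebra"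
proof -
  have "sym_mon [r, s, t] [] = (\<lambda>a. linear_trace (\<lambda>b. eval_word (letter_value b a)
      (Times (Times (Letter (Chi r)) (Letter (Chi s))) (Times (Letter (Chi t)) (Letter Chi0)))))"
    by (auto simp: sym_mon_def linear_trace_coords mult_ac)
  also have "\<dots> \<in> trace_algebra" by (rule word_trace_in_trace_algebra) simp
  finally show ?thesis .
qed

text \<open>
  For the four letters \<open>r, t, s\<close> and one more, the product of two symmetrised quadratic monomials is the
  sum of two of the three symmetrised quartic monomials, one for each splitting into pairs. Solving
  for one of these gives a combination of the three products; the same identity holds with the
  fourth letter replaced by an arbitrary monomial.
\<close>

lemma sym_mon_exchange:
  "2 * sym_mon (r # t # R) (s # S) a =
    sym_mon [r] [s] a * sym_mon (t # R) S a + sym_mon [t] [s] a * sym_mon (r # R) S a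
    - sym_mon [r] [t] a * sym_mon (s # R) S a"
  by (simp add: sym_mon_def algebra_simps)

text \<open>
  Induction on the degree. The congruence means that the monomial is fixed by rotations. A mixed
  monomial of degree at least three loses one \<open>x\<close> and one \<open>y\<close> by \<open>sym_mon_exchange\<close>, which preserves
  the congruence. A pure monomial \<open>x\<^sub>R\<close> has degree divisible by three; multiplying the invariants of
  the first three letters and of the remaining ones gives it up to a mixed monomial of the same
  degree, which is why the mixed case is made available before the case distinction.
\<close>

lemma sym_mon_trace:
  fixes R S :: "'m::finite list"
  assumes "3 dvd length R + 2 * length S"
  shows "sym_mon R S \<in> trace_algebra"
  using assms
proof (induction "length R + length S" arbitrary: R S rule: less_induct)
  case less
  note mult = generated_subalgebra.mult[of _ "{operator_trace h |h. degree_one_in_Chi0 h}",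
      folded trace_algebra_def]
  note add = generated_subalgebra.add[of _ "{operator_trace h |h. degree_one_in_Chi0 h}",
      folded trace_algebra_def]
  note diff = generated_subalgebra_diff[of _ "{operator_trace h |h. degree_one_in_Chi0 h}",
      folded trace_algebra_def]
  have exchange: "sym_mon (r # t # R') (s # S') \<in> trace_algebra"
    if len: "length R' + length S' + 3 = length R + length S"
      and dvd: "3 dvd length R' + 2 * length S' + 4" for r t s :: 'm and R' S'
  proof -
    have *: "sym_mon (x # R') S' \<in> trace_algebra" for x
    proof (rule less.hyps)
      show "3 dvd length (x # R') + 2 * length S'"
        using dvd unfolding list.size by presburger
    qed (use len in simp)
    have "sym_mon (r # t # R') (s # S') = (\<lambda>a. (1/2) *
        (sym_mon [r] [s] a * sym_mon (t # R') S' a + sym_mon [t] [s] a * sym_mon (r # R') S' a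
        - sym_mon [r] [t] a * sym_mon (s # R') S' a))"
      by (rule ext) (simp add: sym_mon_exchange[symmetric])
    also have "\<dots> \<in> trace_algebra"
      using diff[OF add[OF mult[OF sym_mon_2_trace *] mult[OF sym_mon_2_trace *]]
          mult[OF sym_mon_2_trace *]]
      unfolding trace_algebra_def by (intro generated_subalgebra.smult)
    finally show ?thesis .
  qed
  have pure: "sym_mon Q [] \<in> trace_algebra"
    if len: "length Q = length R + length S" and dvd: "3 dvd length Q" for Q :: "'m list"
  proof (cases "length Q < 3")
    case True
    then have "Q = []" using dvd by (cases Q) (auto dest: dvd_imp_le)
    then show ?thesis
      using generated_subalgebra_const[of "2::'a"]
      by (simp add: sym_mon_def[abs_def] trace_algebra_def)
  next
    case False
    then obtain r s t Q' where Q: "Q = r # s # t # Q'"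
      by (cases Q; cases "tl Q"; cases "tl (tl Q)") auto
    show ?thesis
    proof (cases Q')
      case Nil
      then show ?thesis using Q sym_mon_3_trace by simp
    next
      case (Cons x Q'')
      have "sym_mon Q' [] \<in> trace_algebra"
      proof (rule less.hyps)
        show "3 dvd length Q' + 2 * length []"
          using dvd unfolding Q list.size by presburger
      qed (use len Q in simp)
      moreover have "sym_mon (r # s # [t]) (x # Q'') \<in> trace_algebra"
      proof (rule exchange)
        show "3 dvd length [t] + 2 * length Q'' + 4"
          using dvd unfolding Q Cons list.size by presburger
      qed (use len Q Cons in simp)
      ultimately have "(\<lambda>a. sym_mon [r, s, t] [] a * sym_mon Q' [] a
          - sym_mon [r, s, t] Q' a) \<in> trace_algebra"
        using Cons by (intro diff mult sym_mon_3_trace) auto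
      moreover have "sym_mon Q [] = (\<lambda>a. sym_mon [r, s, t] [] a * sym_mon Q' [] a
          - sym_mon [r, s, t] Q' a)"
        unfolding Q by (rule ext) (simp add: sym_mon_def algebra_simps)
      ultimately show ?thesis by simp
    qed
  qed
  consider "R = []" | "S = []" | r s where "R = [r]" "S = [s]"
    | r t R' s S' where "R = r # t # R'" "S = s # S'"
    | s t S' r where "R = [r]" "S = s # t # S'"
    by (cases R; cases "tl R"; cases S; cases "tl S") auto
  then show ?case
  proof cases
    case 1
    then show ?thesis using pure[of S] less.prems sym_mon_commute[of R S]
      by (auto simp: coprime_dvd_mult_right_iff)
  next
    case 2
    then show ?thesis using pure[of R] less.prems by auto
  next
    case 3
    then show ?thesis using sym_mon_2_trace by simp
  next
    case 4
    show ?thesis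
      unfolding 4
    proof (rule exchange)
      show "3 dvd length R' + 2 * length S' + 4"
        using less.prems unfolding 4 list.size by presburger
    qed (use 4 in simp)
  next
    case 5
    have "sym_mon (s # t # S') (r # []) \<in> trace_algebra"
    proof (rule exchange)
      show "3 dvd length S' + 2 * length [] + 4"
        using less.prems unfolding 5 list.size by presburger
    qed (use 5 in simp)
    then show ?thesis using 5 sym_mon_commute by metis
  qed
qed

lemma omega_power_eq_1:
  assumes "\<omega> ^ n = 1"
  shows "3 dvd n"
proof -
  have "\<omega> ^ n = (\<omega> ^ 3) ^ (n div 3) * \<omega> ^ (n mod 3)"
    by (metis mult_div_mod_eq power_add power_mult)
  then have "\<omega> ^ (n mod 3) = 1" using assms omega_cubed by simp
  moreover have "\<omega>\<^sup>2 \<noteq> 1"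
    using omega_cubed omega_neq_1 by (auto simp: power3_eq_cube power2_eq_square)
  moreover have "n mod 3 = 0 \<or> n mod 3 = 1 \<or> n mod 3 = 2" by linarith
  ultimately show ?thesis using omega_neq_1 by (auto simp: dvd_eq_mod_eq_0)
qed

text \<open>
  On a monomial whose weight is not divisible by three, the average over the rotations is a vanishing
  sum \<open>1 + \<eta> + \<eta>\<^sup>2\<close> over cube roots of unity; on the others the average over all six automorphisms is
  three times the symmetrised monomial.
\<close>

lemma invariants_subset_trace_algebra: "invariants \<subseteq> trace_algebra"
proof
  fix f :: "'b ^ 'm::finite \<Rightarrow> 'a" assume f: "f \<in> invariants"
  define avg :: "('b ^ 'm \<Rightarrow> 'a) \<Rightarrow> 'b ^ 'm \<Rightarrow> 'a" where
    "avg h a = (\<Sum>k<3. h (\<chi> r. rotation (\<omega> ^ k) (a $ r)) + h (\<chi> r. swap_rotation (\<omega> ^ k) (a $ r)))"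
    for h a
  have "(polynomial_functions :: ('b ^ 'm \<Rightarrow> 'a) set) \<subseteq> linear_hull {mon R S |R S. True}"
    unfolding polynomial_functions_coords
  proof (rule generated_subalgebra_subset_linear_hull)
    have "(\<lambda>_. 1) = (mon [] [] :: 'b ^ 'm \<Rightarrow> 'a)" by auto
    then show "(\<lambda>_. 1) \<in> {mon R S |R S :: 'm list. True}" by blast
    fix s h :: "'b ^ 'm \<Rightarrow> 'a"
    assume s: "s \<in> range (\<lambda>r a. xc (a $ r)) \<union> range (\<lambda>r a. yc (a $ r))"
      and "h \<in> {mon R S |R S. True}"
    then obtain R S where h: "h = mon R S" by blast
    have "(\<lambda>a. xc (a $ r) * mon R S a) = mon (r # R) S"
      "(\<lambda>a. yc (a $ r) * mon R S a) = mon R (r # S)" for r by auto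
    with s show "(\<lambda>a. s a * h a) \<in> {mon R S |R S. True}"
      unfolding h by auto
  qed
  then have "f \<in> linear_hull {mon R S |R S. True}" using f by (auto simp: invariants_def)
  then have "avg f \<in> trace_algebra"
  proof (induction rule: linear_hull.induct)
    case (base h)
    then obtain R S where h: "h = mon R S" by auto
    define \<eta> where "\<eta> = \<omega> ^ (length R + 2 * length S)"
    have avg: "avg h a = (1 + \<eta> + \<eta>\<^sup>2) * sym_mon R S a" for a
    proof -
      have "(\<omega> ^ k) ^ (length R + 2 * length S) = \<eta> ^ k" for k
        unfolding \<eta>_def by (simp add: power_mult[symmetric] mult.commute)
      then show ?thesis
        by (simp add: avg_def h mon_rotation sym_mon_def numeral_3_eq_3 power2_eq_square algebra_simps)
    qed
    show ?case
    proof (cases "\<eta> = 1")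
      case True
      then have "sym_mon R S \<in> trace_algebra"
        using omega_power_eq_1 sym_mon_trace unfolding \<eta>_def by blast
      then have "(\<lambda>a. (1 + \<eta> + \<eta>\<^sup>2) * sym_mon R S a) \<in> trace_algebra"
        unfolding trace_algebra_def by (rule generated_subalgebra.smult)
      then show ?thesis using avg by presburger
    next
      case False
      have "\<eta> ^ 3 = 1"
        unfolding \<eta>_def using omega_cubed by (metis mult.commute power_mult power_one)
      then have "(\<eta> - 1) * (1 + \<eta> + \<eta>\<^sup>2) = 0"
        by (simp add: algebra_simps power2_eq_square power3_eq_cube)
      with False avg have "avg h = (\<lambda>_. 0)" by auto
      then show ?thesis by (simp add: trace_algebra_def generated_subalgebra_const)
    qed
  next
    case (smult h k)
    have "avg (\<lambda>a. k * h a) = (\<lambda>a. k * avg h a)"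
      by (auto simp: avg_def sum_distrib_left distrib_left)
    then show ?case
      using generated_subalgebra.smult[where c = k] smult.IH by (simp add: trace_algebra_def)
  next
    case (add h h')
    have "avg (\<lambda>a. h a + h' a) = (\<lambda>a. avg h a + avg h' a)"
      by (auto simp: avg_def sum.distrib algebra_simps)
    then show ?case
      using generated_subalgebra.add add.IH by (simp add: trace_algebra_def)
  qed
  moreover have "avg f a = 6 * f a" for a
  proof -
    have "(\<omega> ^ k) ^ 3 = 1" for k
      using omega_cubed by (metis mult.commute power_mult power_one)
    then have "f (\<chi> r. rotation (\<omega> ^ k) (a $ r)) = f a" "f (\<chi> r. swap_rotation (\<omega> ^ k) (a $ r)) = f a"
      for k using f rotation_automorphism by (auto simp: invariants_def)
    then show ?thesis by (simp add: avg_def)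
  qed
  ultimately have "(\<lambda>a. 6 * f a) \<in> trace_algebra" by (metis ext)
  then have "(\<lambda>a. (1/6) * (6 * f a)) \<in> trace_algebra"
    unfolding trace_algebra_def by (rule generated_subalgebra.smult)
  then show "f \<in> trace_algebra" by simp
qed

end

section \<open>Normal forms of simple algebras with an automorphism\<close>

locale closed_planar_algebra = planar_algebra scale u v mult
  for scale :: "'a::{alg_closed_field, field_char_0} \<Rightarrow> 'b::ab_group_add \<Rightarrow> 'b" and u v mult
begin

definition has_normal_form :: bool where
  "has_normal_form \<longleftrightarrow>
    (\<exists>e f c p q d. reflection_algebra scale e f mult c p q d) \<or>
    (\<exists>e f \<omega>. cubic_algebra scale e f mult \<omega>)"

lemma exists_eigenvector:
  assumes g: "Vector_Spaces.linear scale scale g"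
  obtains e f k where "planar_algebra scale e f mult" "g e = scale k e"
proof (cases "yc (g u) = 0")
  case True
  then have "g u = scale (xc (g u)) u" by (intro coords_eqI) simp_all
  then show ?thesis using that planar_algebra_axioms by blast
next
  case False
  let ?\<alpha> = "xc (g u)" and ?\<beta> = "xc (g v)" and ?\<gamma> = "yc (g u)" and ?\<delta> = "yc (g v)"
  obtain k where "poly [:?\<alpha> * ?\<delta> - ?\<beta> * ?\<gamma>, - (?\<alpha> + ?\<delta>), 1:] k = 0"
    using alg_closed_imp_poly_has_root[of "[:?\<alpha> * ?\<delta> - ?\<beta> * ?\<gamma>, - (?\<alpha> + ?\<delta>), 1:]"] by auto
  then have k: "k * k = (?\<alpha> + ?\<delta>) * k - (?\<alpha> * ?\<delta> - ?\<beta> * ?\<gamma>)"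
    by (simp add: algebra_simps)
  \<comment> \<open>The entries annihilate the second row \<open>(\<gamma>, \<delta> - k)\<close> of \<open>g - k\<close>, and hence, the determinant being
    zero, also the first one.\<close>
  define e where "e = scale (k - ?\<delta>) u + scale ?\<gamma> v"
  have xe: "xc e = k - ?\<delta>" and ye: "yc e = ?\<gamma>" by (simp_all add: e_def)
  have "xc e * yc u \<noteq> yc e * xc u" using False by (simp add: ye)
  moreover have "g e = scale k e"
  proof (rule coords_eqI)
    have "(k - ?\<delta>) * ?\<alpha> + ?\<gamma> * ?\<beta> = k * (k - ?\<delta>)" using k by (simp add: algebra_simps)
    then show "xc (g e) = xc (scale k e)" using coords_linear(1)[OF g, of e] by (simp add: xe ye)
    show "yc (g e) = yc (scale k e)"
      using coords_linear(2)[OF g, of e] by (simp add: xe ye algebra_simps)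
  qed
  ultimately show ?thesis using that basis_change by blast
qed

lemma exists_primitive_cube_root:
  obtains \<omega> :: 'a where "\<omega> ^ 3 = 1" "\<omega> \<noteq> 1"
proof -
  obtain \<omega> :: 'a where "poly [:1, 1, 1:] \<omega> = 0"
    using alg_closed_imp_poly_has_root[of "[:1, 1, 1 :: 'a:]"] by auto
  then have w: "1 + \<omega> + \<omega> * \<omega> = 0" by (simp add: algebra_simps)
  have "\<omega> ^ 3 - 1 = (\<omega> - 1) * (1 + \<omega> + \<omega> * \<omega>)"
    by (simp add: algebra_simps power3_eq_cube)
  then have "\<omega> ^ 3 = 1" using w by simp
  moreover have "\<omega> \<noteq> 1" using w by auto
  ultimately show ?thesis using that by blast
qed

text \<open>
  In the basis \<open>s u\<close>, \<open>s\<^sup>2 b v\<close> the first product is normalised, and the second one is as soon as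
  \<open>s\<^sup>3 b\<^sup>2 a = 1\<close>.
\<close>

lemma cubic_normal_form:
  assumes uu: "mult u u = scale b v" and vv: "mult v v = scale a u"
    and uv: "mult u v = 0" and vu: "mult v u = 0"
    and nonzero: "a \<noteq> 0" "b \<noteq> 0"
  shows has_normal_form
proof -
  obtain s where s: "s ^ 3 = 1 / (b\<^sup>2 * a)" using nth_root_exists[of 3 "1 / (b\<^sup>2 * a)"] by auto
  then have s0: "s \<noteq> 0" using nonzero by auto
  have s4: "(s * s * b) * (s * s * b) * a = s"
    using s nonzero by (simp add: field_simps power3_eq_cube power2_eq_square)
  obtain \<omega> :: 'a where "\<omega> ^ 3 = 1" "\<omega> \<noteq> 1" by (rule exists_primitive_cube_root)
  moreover have "planar_algebra scale (scale s u) (scale (s * s * b) v) mult"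
    by (rule basis_change) (use s0 nonzero in simp)
  ultimately have "cubic_algebra scale (scale s u) (scale (s * s * b) v) mult \<omega>"
    unfolding cubic_algebra_def cubic_algebra_axioms_def
    using s4 by (simp add: mult_simps uu vv uv vu mult_ac)
  then show ?thesis unfolding has_normal_form_def by blast
qed

text \<open>
  The exceptional case \<open>p = q = -d\<close> is the cubic algebra in disguise: after scaling,
  \<open>u u = v\<close>, \<open>u v = v u = -u\<close>, \<open>v v = v\<close>, and then \<open>(v + u)/2\<close> and \<open>(v - u)/2\<close> are squares of each
  other with product zero.
\<close>

lemma reflection_normal_form:
  assumes uu: "mult u u = scale c v" and vv: "mult v v = scale d v"
    and uv: "mult u v = scale p u" and vu: "mult v u = scale q u"
    and nonzero: "c \<noteq> 0" "p \<noteq> 0 \<or> q \<noteq> 0"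
  shows has_normal_form
proof (cases "q + d \<noteq> 0 \<or> p + d \<noteq> 0")
  case True
  then have "reflection_algebra scale u v mult c p q d"
    using assms by unfold_locales auto
  then show ?thesis unfolding has_normal_form_def by blast
next
  case False
  then have p: "p = - d" and q: "q = - d" by (auto simp: add_eq_0_iff2)
  with nonzero have d: "d \<noteq> 0" by auto
  \<comment> \<open>The scaled vectors are \<open>s u\<close> and \<open>v / d\<close>; this choice of \<open>s\<close> makes the square of the first
    one equal to the second.\<close>
  obtain s where s: "s ^ 2 = 1 / (c * d)" using nth_root_exists[of 2 "1 / (c * d)"] by auto
  then have s0: "s \<noteq> 0" and ss: "c * (s * s) = 1 / d"
    using nonzero d by (auto simp: power2_eq_square)
  define e where "e = scale (s / 2) u + scale (1 / (2 * d)) v"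
  define f where "f = scale (- (s / 2)) u + scale (1 / (2 * d)) v"
  have coords: "xc e = s / 2" "yc e = 1 / (2 * d)" "xc f = - (s / 2)" "yc f = 1 / (2 * d)"
    by (simp_all add: e_def f_def)
  have xm: "xc (mult z z') = - d * (xc z * yc z' + yc z * xc z')"
    and ym: "yc (mult z z') = c * (xc z * xc z') + d * (yc z * yc z')" for z z'
    using coords_mult[of z z'] by (simp_all add: uu uv vu vv p q algebra_simps)
  have ss4: "c * (s / 2 * (s / 2)) = 1 / (4 * d)"
    using ss by (simp add: field_simps)
  have "planar_algebra scale e f mult"
    by (rule basis_change) (use s0 d in \<open>simp add: coords field_simps\<close>)
  moreover have "mult e e = f" "mult f f = e" "mult e f = 0" "mult f e = 0"
    using d ss4 by (auto intro!: coords_eqI simp: xm ym coords field_simps)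
  moreover obtain \<omega> :: 'a where "\<omega> ^ 3 = 1" "\<omega> \<noteq> 1" by (rule exists_primitive_cube_root)
  ultimately have "cubic_algebra scale e f mult \<omega>"
    unfolding cubic_algebra_def cubic_algebra_axioms_def by simp
  then show ?thesis unfolding has_normal_form_def by blast
qed

lemma automorphism_eigenvalue_nonzero:
  assumes g: "g \<in> Aut" and x: "g x = scale k x" "x \<noteq> 0"
  shows "k \<noteq> 0"
proof
  assume "k = 0"
  with x have "g x = 0" by simp
  moreover have "g 0 = 0" using g linear_simps(2)[of g 0 0] by (simp add: Aut_def)
  moreover have "inj g" using g by (simp add: Aut_def bij_def)
  ultimately show False using x(2) by (metis injD)
qed

text \<open>
  If the matrix of \<open>g\<close>, upper triangular with respect to \<open>u, v\<close>, had only the eigenvalue \<open>k\<close>, comparing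
  coordinates in \<open>g (z z') = g z g z'\<close> would make the line through \<open>u\<close> an ideal. For \<open>k \<noteq> 1\<close> this is
  because \<open>k\<^sup>2 \<noteq> k\<close>. For \<open>k = 1\<close> the off-diagonal entry \<open>n\<close> is nonzero, and one finds in turn that \<open>u u\<close> is a
  multiple of \<open>u\<close>, that the \<open>v\<close>-coordinates of \<open>u v\<close> and \<open>v u\<close> are both equal to the factor, and, from
  \<open>v v\<close>, that twice this factor is zero.
\<close>

lemma automorphism_diagonalizable:
  assumes simple and g: "g \<in> Aut" "g \<noteq> id" and gu: "g u = scale k u"
  obtains w l where "planar_algebra scale u w mult" "g w = scale l w" "l \<noteq> k"
proof -
  have lin: "Vector_Spaces.linear scale scale g"
    and hom: "\<And>x y. g (mult x y) = mult (g x) (g y)"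
    using g(1) by (auto simp: Aut_def)
  define l n where "l = yc (g v)" and "n = xc (g v)"
  have gv: "g v = scale l v + scale n u" by (rule coords_eqI) (simp_all add: l_def n_def)
  have xg: "xc (g z) = k * xc z + n * yc z" and yg: "yc (g z) = l * yc z" for z
    using coords_linear[OF lin, of z] by (simp_all add: gu gv mult_ac)
  have k0: "k \<noteq> 0" using automorphism_eigenvalue_nonzero[OF g(1) gu] by simp
  have "l \<noteq> k"
  proof
    assume lk: "l = k"
    have xuu: "k * xc (mult u u) + n * yc (mult u u) = k * k * xc (mult u u)"
      and yuu: "k * yc (mult u u) = k * k * yc (mult u u)"
      using arg_cong[OF hom[of u u], of xc] arg_cong[OF hom[of u u], of yc]
      by (simp_all add: xg yg gu lk mult_simps)
    have xuv: "k * xc (mult u v) + n * yc (mult u v) = k * k * xc (mult u v) + k * n * xc (mult u u)"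
      and yuv: "k * yc (mult u v) = k * k * yc (mult u v) + k * n * yc (mult u u)"
      using arg_cong[OF hom[of u v], of xc] arg_cong[OF hom[of u v], of yc]
      by (simp_all add: xg yg gu gv lk mult_simps algebra_simps)
    have xvu: "k * xc (mult v u) + n * yc (mult v u) = k * k * xc (mult v u) + k * n * xc (mult u u)"
      and yvu: "k * yc (mult v u) = k * k * yc (mult v u) + k * n * yc (mult u u)"
      using arg_cong[OF hom[of v u], of xc] arg_cong[OF hom[of v u], of yc]
      by (simp_all add: xg yg gu gv lk mult_simps algebra_simps)
    have yvv: "k * yc (mult v v) = k * k * yc (mult v v) + k * n * yc (mult u v)
        + k * n * yc (mult v u) + n * n * yc (mult u u)"
      using arg_cong[OF hom[of v v], of yc]
      by (simp add: xg yg gv lk mult_simps algebra_simps)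
    show False
    proof (cases "k = 1")
      case True
      have "n \<noteq> 0"
      proof
        assume "n = 0"
        then have "g z = z" for z by (intro coords_eqI) (simp_all add: xg yg lk True)
        then show False using g(2) by auto
      qed
      moreover have "yc (mult u u) = 0" using xuu \<open>n \<noteq> 0\<close> True by simp
      moreover have "yc (mult u v) = xc (mult u u)" "yc (mult v u) = xc (mult u u)"
        using xuv xvu \<open>n \<noteq> 0\<close> True by simp_all
      moreover from this have "n * (2 * xc (mult u u)) = 0"
        using yvv \<open>yc (mult u u) = 0\<close> True by (simp add: algebra_simps)
      ultimately show False using simple_lines_not_ideals(1)[OF assms(1)] by simp
    next
      case False
      have "yc (mult u u) = 0" using yuu k0 False by simp
      moreover have "yc (mult u v) = 0" "yc (mult v u) = 0"
        using yuv yvu k0 False calculation by simp_all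
      ultimately show False using simple_lines_not_ideals(1)[OF assms(1)] by simp
    qed
  qed
  define w where "w = scale (n / (l - k)) u + v"
  have xw: "xc w = n / (l - k)" and yw: "yc w = 1" by (simp_all add: w_def)
  have "planar_algebra scale u w mult" by (rule basis_change) (simp add: yw)
  moreover have "g w = scale l w"
    using \<open>l \<noteq> k\<close> by (intro coords_eqI) (simp_all add: xg yg xw yw field_simps)
  ultimately show ?thesis using that \<open>l \<noteq> k\<close> by blast
qed

lemma eigenvector_product:
  assumes "g \<in> Aut" and "g u = scale k u" "g v = scale l v" and "g x = scale r x" "g y = scale s y"
  shows "k * xc (mult x y) = r * s * xc (mult x y)" "l * yc (mult x y) = r * s * yc (mult x y)"
proof -
  have lin: "Vector_Spaces.linear scale scale g" and hom: "g (mult x y) = mult (g x) (g y)"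
    using assms(1) by (auto simp: Aut_def)
  have "g (mult x y) = scale (r * s) (mult x y)"
    by (simp add: hom assms mult_simps mult.commute)
  then show "k * xc (mult x y) = r * s * xc (mult x y)" "l * yc (mult x y) = r * s * yc (mult x y)"
    using coords_linear[OF lin, of "mult x y"] by (auto simp: assms(2,3) mult.commute)
qed

text \<open>
  Products of eigenvectors are eigenvectors or zero, so every structure constant that does not fit the
  eigenvalues vanishes. Simplicity ensures that the remaining ones are not too few: neither the line
  through \<open>u\<close> nor the line through \<open>v\<close> is an ideal.
\<close>

lemma fixed_vector_normal_form:
  assumes simple and g: "g \<in> Aut" "g u = scale k u" "g v = v" and k: "k \<noteq> 1"
  shows has_normal_form
proof -
  have gv: "g v = scale 1 v" using g(3) by simp
  note product = eigenvector_product[OF g(1,2) gv]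
  have k0: "k \<noteq> 0" using automorphism_eigenvalue_nonzero[OF g(1,2)] by simp
  have uu: "xc (mult u u) = 0" using product(1)[OF g(2) g(2)] k k0 by simp
  have uv: "yc (mult u v) = 0" using product(2)[OF g(2) gv] k by simp
  have vu: "yc (mult v u) = 0" using product(2)[OF gv g(2)] k by simp
  have vv: "xc (mult v v) = 0" using product(1)[OF gv gv] k by simp
  show ?thesis
  proof (rule reflection_normal_form)
    show "mult u u = scale (yc (mult u u)) v" "mult v v = scale (yc (mult v v)) v"
      "mult u v = scale (xc (mult u v)) u" "mult v u = scale (xc (mult v u)) u"
      using uu uv vu vv by (auto intro: coords_eqI)
    show "yc (mult u u) \<noteq> 0" "xc (mult u v) \<noteq> 0 \<or> xc (mult v u) \<noteq> 0"
      using simple_lines_not_ideals[OF assms(1)] uv vu vv by auto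
  qed
qed

lemma no_fixed_vector_normal_form:
  assumes simple and g: "g \<in> Aut" "g u = scale k u" "g v = scale l v"
    and kl: "k \<noteq> 1" "l \<noteq> 1"
  shows has_normal_form
proof -
  note product = eigenvector_product[OF g]
  have k0: "k \<noteq> 0" using automorphism_eigenvalue_nonzero[OF g(1,2)] by simp
  have l0: "l \<noteq> 0" using automorphism_eigenvalue_nonzero[OF g(1,3)] by simp
  have uu: "xc (mult u u) = 0" using product(1)[OF g(2) g(2)] kl k0 by simp
  have vv: "yc (mult v v) = 0" using product(2)[OF g(3) g(3)] kl l0 by simp
  have uv: "xc (mult u v) = 0" "yc (mult u v) = 0"
    using product[OF g(2) g(3)] kl k0 l0 by simp_all
  have vu: "xc (mult v u) = 0" "yc (mult v u) = 0"
    using product[OF g(3) g(2)] kl k0 l0 by simp_all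
  show ?thesis
  proof (rule cubic_normal_form)
    show "mult u u = scale (yc (mult u u)) v" "mult v v = scale (xc (mult v v)) u"
      "mult u v = 0" "mult v u = 0"
      using uu uv vu vv by (auto intro: coords_eqI)
    show "xc (mult v v) \<noteq> 0" "yc (mult u u) \<noteq> 0"
      using simple_lines_not_ideals[OF assms(1)] uv vu by auto
  qed
qed

lemma simple_with_automorphism_normal_form:
  assumes simple and "Aut \<noteq> {id}"
  shows has_normal_form
proof -
  have "id \<in> Aut" by (auto simp: Aut_def intro: linearI)
  then obtain g where g: "g \<in> Aut" "g \<noteq> id" using assms(2) by auto
  then have "Vector_Spaces.linear scale scale g" by (simp add: Aut_def)
  then obtain e f k where e: "planar_algebra scale e f mult" "g e = scale k e"
    by (rule exists_eigenvector)
  interpret P: closed_planar_algebra scale e f mult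
    using e(1) by (rule closed_planar_algebra.intro)
  obtain w l where w: "planar_algebra scale e w mult" "g w = scale l w" "l \<noteq> k"
    using assms(1) g e(2) by (rule P.automorphism_diagonalizable)
  interpret Q: closed_planar_algebra scale e w mult
    using w(1) by (rule closed_planar_algebra.intro)
  interpret R: closed_planar_algebra scale w e mult
    by (intro closed_planar_algebra.intro Q.basis_change) simp
  consider "l = 1" | "k = 1" | "l \<noteq> 1" "k \<noteq> 1" by blast
  then show ?thesis
  proof cases
    case 1
    then show ?thesis using Q.fixed_vector_normal_form[OF assms(1) g(1) e(2)] w by simp
  next
    case 2
    then show ?thesis using R.fixed_vector_normal_form[OF assms(1) g(1) w(2)] w e by simp
  next
    case 3
    then show ?thesis using Q.no_fixed_vector_normal_form[OF assms(1) g(1) e(2) w(2)] by simp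
  qed
qed

end

theorem corollary7p9:
  fixes scale :: "'a::{alg_closed_field, field_char_0} \<Rightarrow> 'b::ab_group_add \<Rightarrow> 'b"
    and Basis :: "'b set"
    and mult :: "'b \<Rightarrow> 'b \<Rightarrow> 'b"
  assumes "nonassoc_algebra scale Basis mult"
    and "vector_space.dim scale (UNIV :: 'b set) = 2"
    and "nonassoc_algebra.simple scale mult"
    and "nonassoc_algebra.Aut scale mult \<noteq> {id}"
  shows "(nonassoc_algebra.invariants scale Basis mult :: ('b ^ 'm::finite \<Rightarrow> 'a) set)
    = nonassoc_algebra.trace_algebra scale Basis mult"
proof -
  interpret nonassoc_algebra scale Basis mult by fact
  have "card Basis = 2"
    using assms(2) dim_eq_card[of Basis UNIV] by (simp add: span_Basis independent_Basis)
  then obtain u v where uv: "Basis = {u, v}" "u \<noteq> v" by (auto simp: card_2_iff)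
  then interpret U: closed_planar_algebra scale u v mult
    using assms(1) by (intro closed_planar_algebra.intro planar_algebra.intro
        planar_algebra_axioms.intro) auto
  have "(invariants :: ('b ^ 'm \<Rightarrow> 'a) set) \<subseteq> trace_algebra"
    if C: "nonassoc_algebra scale C mult"
      and eq: "(nonassoc_algebra.invariants scale C mult :: ('b ^ 'm \<Rightarrow> 'a) set)
        \<subseteq> nonassoc_algebra.trace_algebra scale C mult" for C
    using eq invariants_basis_independent[OF assms(1) C, where 'm = 'm]
      trace_algebra_basis_independent[OF C, where 'm = 'm] by simp
  note reduce = this
  from U.simple_with_automorphism_normal_form[OF assms(3,4)]
  have "(invariants :: ('b ^ 'm \<Rightarrow> 'a) set) \<subseteq> trace_algebra"
    unfolding U.has_normal_form_def
  proof (elim disjE exE)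
    fix e f c p q d assume "reflection_algebra scale e f mult c p q d"
    then interpret N: reflection_algebra scale e f mult c p q d .
    show ?thesis by (rule reduce[OF N.nonassoc_algebra_axioms N.invariants_subset_trace_algebra])
  next
    fix e f \<omega> assume "cubic_algebra scale e f mult \<omega>"
    then interpret N: cubic_algebra scale e f mult \<omega> .
    show ?thesis by (rule reduce[OF N.nonassoc_algebra_axioms N.invariants_subset_trace_algebra])
  qed
  with trace_algebra_subset_invariants show ?thesis by blast
qed

end
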